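(* There exists a perfect $1$-error-correcting code in the Cartesian product $C_6 \square C_6 \square C_2$.
   Context: All graphs are simple; $d(x,y)$ is the shortest-path distance. $C_6$ is the cycle on $6$ vertices and, by convention, $C_2$ is a single edge ($K_2$). The Cartesian product $G\square H$ has vertex set $V(G)\times V(H)$, with $(g_1,h_1)$ adjacent to $(g_2,h_2)$ iff either $h_1=h_2$ and $g_1g_2\in E(G)$, or $g_1=g_2$ and $h_1h_2\in E(H)$. A code is a subset $D$ of the vertex set; it is a perfect $1$-error-correcting code if any two distinct codewords are at distance at least $3$ and every vertex is at distance at most $1$ from some codeword. *)

theory Defs
  imports "Graph_Theory.Pair_Digraph" "Graph_Theory.Shortest_Path"
begin

text \<open>
  A finite simple graph is a \<^locale>\<open>pair_graph\<close>: an undirected edge \<open>uv\<close> is the pair of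
  arcs \<open>(u, v)\<close>, \<open>(v, u)\<close>.
\<close>

text \<open>
  Intended for \<open>n \<ge> 2\<close>. For \<open>n = 2\<close> the two disjuncts coincide, which yields the
  single edge $K_2$.
\<close>
definition cycle_graph :: "nat \<Rightarrow> nat pair_pre_digraph" where
  "cycle_graph n =
    \<lparr> pverts = {..<n},
      parcs = {(i, j). i < n \<and> j < n \<and> (j = Suc i mod n \<or> i = Suc j mod n)} \<rparr>"

definition cartesian_product ::
  "'a pair_pre_digraph \<Rightarrow> 'b pair_pre_digraph \<Rightarrow> ('a \<times> 'b) pair_pre_digraph"
  (infixl \<open>\<box>\<close> 70) where
  "G \<box> H =
    \<lparr> pverts = pverts G \<times> pverts H,
      parcs = {((g1, h1), (g2, h2)).
        (h1 = h2 \<and> h1 \<in> pverts H \<and> (g1, g2) \<in> parcs G) \<or>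
        (g1 = g2 \<and> g1 \<in> pverts G \<and> (h1, h2) \<in> parcs H)} \<rparr>"

text \<open>The distance is \<open>\<infinity>\<close> for vertices in different components.\<close>
definition graph_dist :: "'a pair_pre_digraph \<Rightarrow> 'a \<Rightarrow> 'a \<Rightarrow> ereal" where
  "graph_dist G = wf_digraph.\<mu> (with_proj G) (\<lambda>_. 1)"

definition perfect_1_code :: "'a pair_pre_digraph \<Rightarrow> 'a set \<Rightarrow> bool" where
  "perfect_1_code G D \<longleftrightarrow>
     D \<subseteq> pverts G \<and>
     (\<forall>x\<in>D. \<forall>y\<in>D. x \<noteq> y \<longrightarrow> 3 \<le> graph_dist G x y) \<and>
     (\<forall>v\<in>pverts G. \<exists>x\<in>D. graph_dist G v x \<le> 1)"

lemma pair_graph_cycle_graph: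
  assumes "2 \<le> n"
  shows "pair_graph (cycle_graph n)"
proof -
  have "finite {(i, j). i < n \<and> j < n \<and> (j = Suc i mod n \<or> i = Suc j mod n)}"
    by (rule finite_subset[of _ "{..<n} \<times> {..<n}"]) auto
  moreover have "Suc i mod n \<noteq> i" "i \<noteq> Suc i mod n" if "i < n" for i
    using that assms by (cases "Suc i = n"; auto)+
  ultimately show ?thesis
    by unfold_locales (auto simp: cycle_graph_def symmetric_def intro: symI)
qed

lemma parcs_cycle_graph_2: "parcs (cycle_graph 2) = {(0, 1), (1, 0)}"
  by (auto simp: cycle_graph_def less_2_cases_iff)

lemma pair_graph_cartesian_product:
  assumes "pair_graph G" and "pair_graph H"
  shows "pair_graph (G \<box> H)"
proof -
  interpret G: pair_graph G by fact
  interpret H: pair_graph H by fact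
  have sub: "parcs (G \<box> H) \<subseteq> (pverts G \<times> pverts H) \<times> (pverts G \<times> pverts H)"
    by (auto simp: cartesian_product_def dest: G.wellformed' H.wellformed')
  have fin: "finite (parcs (G \<box> H))"
    by (rule finite_subset[OF sub])
      (simp add: G.pair_finite_verts H.pair_finite_verts)
  have symG: "sym (parcs G)" and symH: "sym (parcs H)"
    using G.pair_sym_arcs H.pair_sym_arcs by (auto simp: symmetric_def)
  have sym: "sym (parcs (G \<box> H))"
    by (rule symI) (auto simp: cartesian_product_def dest: symD[OF symG] symD[OF symH])
  have loopfree: "fst e \<noteq> snd e" if "e \<in> parcs (G \<box> H)" for e
    using that by (auto simp: cartesian_product_def dest: G.pair_no_loops H.pair_no_loops)
  have verts: "pverts (G \<box> H) = pverts G \<times> pverts H"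
    by (simp add: cartesian_product_def)
  show ?thesis
  proof
    show "fst e \<in> pverts (G \<box> H)" "snd e \<in> pverts (G \<box> H)" if "e \<in> parcs (G \<box> H)" for e
      using that sub by (auto simp: verts)
    show "finite (pverts (G \<box> H))"
      by (simp add: verts G.pair_finite_verts H.pair_finite_verts)
  qed (use fin sym loopfree in \<open>auto simp: symmetric_def\<close>)
qed

end

theory Submission
  imports Defs "HOL-Number_Theory.Cong"
begin

text \<open>
  The code is the kernel of the homomorphism \<open>(x, y, z) \<mapsto> x + 2y + 3z\<close> from
  \<open>\<int>\<^sub>6 \<times> \<int>\<^sub>6 \<times> \<int>\<^sub>2\<close> to \<open>\<int>\<^sub>6\<close>. The five unit steps \<open>\<plusminus>e\<^sub>1\<close>, \<open>\<plusminus>e\<^sub>2\<close>, \<open>e\<^sub>3\<close> are sent to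
  \<open>\<plusminus>1\<close>, \<open>\<plusminus>2\<close>, \<open>3\<close>, so on every ball of radius 1 the homomorphism is a bijection onto
  \<open>\<int>\<^sub>6\<close>, and each ball contains exactly one codeword.
\<close>

text \<open>The distance is an infimum over walks, so one explicit walk bounds it: the empty walk or
  a single arc.\<close>

lemma graph_dist_le_1:
  assumes "pair_wf_digraph G" and "u \<in> pverts G" and "u = v \<or> (u, v) \<in> parcs G"
  shows "graph_dist G u v \<le> 1"
proof -
  interpret pair_wf_digraph G by fact
  show ?thesis
  proof (cases "u = v")
    case True
    have "awalk u [] v"
      using True assms(2) by (simp add: awalk_Nil_iff)
    then have "\<mu> (\<lambda>_. 1) u v \<le> ereal (awalk_cost (\<lambda>_. 1) [])"
      by (rule min_cost_le_walk_cost)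
    also have "\<dots> \<le> 1"
      by simp
    finally show ?thesis
      unfolding graph_dist_def .
  next
    case False
    then have "awalk u [(u, v)] v"
      using assms(3) by (auto simp: awalk_Cons_iff awalk_Nil_iff dest: in_arcsD2)
    then have "\<mu> (\<lambda>_. 1) u v \<le> ereal (awalk_cost (\<lambda>_. 1) [(u, v)])"
      by (rule min_cost_le_walk_cost)
    then show ?thesis
      by (simp add: graph_dist_def one_ereal_def)
  qed
qed

text \<open>With unit weights the cost of a walk is its length, and the hypotheses exclude lengths
  0, 1 and 2 in turn. If no walk exists, the infimum is infinite and the bound still holds.\<close>

lemma graph_dist_ge_3:
  assumes "pair_wf_digraph G" and "u \<noteq> v" and "(u, v) \<notin> parcs G"
    and "\<And>w. (u, w) \<in> parcs G \<Longrightarrow> (w, v) \<in> parcs G \<Longrightarrow> False"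
  shows "3 \<le> graph_dist G u v"
proof -
  interpret pair_wf_digraph G by fact
  have cost: "awalk_cost (\<lambda>_. 1) p = real (length p)" for p :: "('a \<times> 'a) list"
    by (induction p) auto
  have "3 \<le> length p" if "awalk u p v" for p
  proof (rule ccontr)
    assume "\<not> 3 \<le> length p"
    then consider "p = []" | a where "p = [a]" | a b where "p = [a, b]"
      by (cases p; cases "tl p"; cases "tl (tl p)") auto
    then show False
      using that assms(2-4) by cases (auto simp: awalk_Cons_iff awalk_Nil_iff)
  qed
  then show ?thesis
    unfolding graph_dist_def \<mu>_def
    by (intro INF_greatest) (force simp: cost)
qed

text \<open>The weight 3 on \<open>z\<close> is compatible with arithmetic modulo 2, because 3 * 2 =
  0 modulo 6.\<close>

definition syndrome :: "(nat \<times> nat) \<times> nat \<Rightarrow> nat" where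
  "syndrome = (\<lambda>((x, y), z). (x + 2 * y + 3 * z) mod 6)"

abbreviation C\<^sub>6\<^sub>6\<^sub>2 :: "((nat \<times> nat) \<times> nat) pair_pre_digraph" where
  "C\<^sub>6\<^sub>6\<^sub>2 \<equiv> cycle_graph 6 \<box> cycle_graph 6 \<box> cycle_graph 2"

text \<open>The index \<open>d\<close> is the amount by which the move changes the syndrome modulo
  6. A backward move on a 6-cycle is written as adding 5, which avoids truncated subtraction; the
  last branch is meant for \<open>d = 3\<close>.\<close>

definition step :: "nat \<Rightarrow> (nat \<times> nat) \<times> nat \<Rightarrow> (nat \<times> nat) \<times> nat" where
  "step d = (\<lambda>((x, y), z).
     if d = 1 then (((x + 1) mod 6, y), z)
     else if d = 5 then (((x + 5) mod 6, y), z)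
     else if d = 2 then ((x, (y + 1) mod 6), z)
     else if d = 4 then ((x, (y + 5) mod 6), z)
     else ((x, y), 1 - z))"

lemma pverts_C662: "pverts C\<^sub>6\<^sub>6\<^sub>2 = ({..<6} \<times> {..<6}) \<times> {..<2}"
  by (simp add: cartesian_product_def cycle_graph_def)

lemma cycle_graph_6_arc_iff:
  "(i, j) \<in> parcs (cycle_graph 6) \<longleftrightarrow> i < 6 \<and> (j = (i + 1) mod 6 \<or> j = (i + 5) mod 6)"
proof -
  have "i = Suc j mod 6 \<longleftrightarrow> j = (i + 5) mod 6" if "i < 6" "j < 6"
    using that by (cases i; cases "j = 5") (auto simp: mod_Suc)
  then show ?thesis
    by (auto simp: cycle_graph_def)
qed

lemma cycle_graph_2_arc_iff: "(i, j) \<in> parcs (cycle_graph 2) \<longleftrightarrow> i < 2 \<and> j = 1 - i"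
  by (auto simp: parcs_cycle_graph_2 less_2_cases_iff)

text \<open>Labels every arc by its effect on the syndrome, so that questions about adjacency become
  arithmetic on \<open>d\<close>.\<close>

lemma C662_arc_iff:
  "(u, v) \<in> parcs C\<^sub>6\<^sub>6\<^sub>2 \<longleftrightarrow> u \<in> pverts C\<^sub>6\<^sub>6\<^sub>2 \<and> (\<exists>d\<in>{1, 2, 3, 4, 5}. v = step d u)"
proof -
  obtain x y z x' y' z' where uv: "u = ((x, y), z)" "v = ((x', y'), z')"
    by (metis surj_pair)
  have "(u, v) \<in> parcs C\<^sub>6\<^sub>6\<^sub>2 \<longleftrightarrow>
      z = z' \<and> z < 2 \<and> (y = y' \<and> y < 6 \<and> (x, x') \<in> parcs (cycle_graph 6) \<or>
        x = x' \<and> x < 6 \<and> (y, y') \<in> parcs (cycle_graph 6)) \<or>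
      x = x' \<and> y = y' \<and> x < 6 \<and> y < 6 \<and> (z, z') \<in> parcs (cycle_graph 2)"
    unfolding uv by (auto simp: cartesian_product_def) (auto simp: cycle_graph_def)
  then show ?thesis
    unfolding cycle_graph_6_arc_iff cycle_graph_2_arc_iff
    by (simp add: uv pverts_C662 step_def del: One_nat_def) blast
qed

lemma syndrome_step:
  assumes "u \<in> pverts C\<^sub>6\<^sub>6\<^sub>2" and "d \<in> {1, 2, 3, 4, 5}"
  shows "syndrome (step d u) = (syndrome u + d) mod 6"
proof -
  obtain x y z where u: "u = ((x, y), z)" and z: "z = 0 \<or> z = 1"
    using assms(1) by (auto simp: pverts_C662 less_2_cases_iff)
  have y_step: "(x + 2 * ((y + c) mod 6) + 3 * z) mod 6 = (x + 2 * (y + c) + 3 * z) mod 6" for c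
    unfolding cong_def[symmetric] by (intro cong_add cong_mult cong_refl) (simp add: cong_def)
  have s2: "(x + 2 * ((y + 1) mod 6) + 3 * z) mod 6 = (x + 2 * y + 3 * z + 2) mod 6"
    unfolding y_step by (simp add: algebra_simps)
  \<comment> \<open>Adding 5 to \<open>y\<close> contributes 10, which is 4 modulo 6.\<close>
  have s4: "(x + 2 * ((y + 5) mod 6) + 3 * z) mod 6 = (x + 2 * y + 3 * z + 4) mod 6"
    unfolding y_step using mod_add_self2[of "x + 2 * y + 3 * z + 4" 6]
    by (simp add: algebra_simps)
  have s15: "((x + c) mod 6 + 2 * y + 3 * z) mod 6 = (x + 2 * y + 3 * z + c) mod 6" for c
    using mod_add_left_eq[of "x + c" 6 "2 * y + 3 * z"] by (simp add: add_ac)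
  \<comment> \<open>Flipping \<open>z\<close> adds or subtracts 3, and these agree modulo 6.\<close>
  have s3: "(x + 2 * y + 3 * (1 - z)) mod 6 = (x + 2 * y + 3 * z + 3) mod 6"
    using z mod_add_self2[of "x + 2 * y" 6] by auto
  consider "d = 1" | "d = 2" | "d = 3" | "d = 4" | "d = 5"
    using assms(2) by blast
  then show ?thesis
    by cases (simp_all add: u step_def syndrome_def mod_add_left_eq s2 s3 s4 s15
        del: One_nat_def add_2_eq_Suc')
qed

lemma syndrome_less_6: "syndrome v < 6"
  by (simp add: syndrome_def split: prod.split)

lemma syndrome_arc_neq:
  assumes "(u, v) \<in> parcs C\<^sub>6\<^sub>6\<^sub>2"
  shows "syndrome u \<noteq> syndrome v"
proof -
  obtain d where u: "u \<in> pverts C\<^sub>6\<^sub>6\<^sub>2" and d: "d \<in> {1, 2, 3, 4, 5}" and v: "v = step d u"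
    using assms unfolding C662_arc_iff by blast
  have "1 \<le> d" "d < 6"
    using d by auto
  \<comment> \<open>Without wrap-around the value exceeds \<open>s\<close>; with it,
    \<open>s + d - 6\<close> lies below \<open>s\<close>.\<close>
  then have "s \<noteq> (s + d) mod 6" if "s < 6" for s
    using that by (cases "s + d < 6") (auto simp: le_mod_geq)
  then show ?thesis
    using syndrome_less_6[of u] unfolding v syndrome_step[OF u d] .
qed

text \<open>The syndromes of \<open>w\<close> and of a neighbour determine the label
  \<open>d\<close> of the arc between them, hence the neighbour. This rules out two codewords at
  distance 2.\<close>

lemma syndrome_inj_on_neighbours:
  assumes "(w, u) \<in> parcs C\<^sub>6\<^sub>6\<^sub>2" and "(w, v) \<in> parcs C\<^sub>6\<^sub>6\<^sub>2" and "syndrome u = syndrome v"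
  shows "u = v"
proof -
  obtain d e where w: "w \<in> pverts C\<^sub>6\<^sub>6\<^sub>2"
    and d: "d \<in> {1, 2, 3, 4, 5}" and u: "u = step d w"
    and e: "e \<in> {1, 2, 3, 4, 5}" and v: "v = step e w"
    using assms(1,2) unfolding C662_arc_iff by blast
  have "[syndrome w + d = syndrome w + e] (mod 6)"
    using assms(3) unfolding u v syndrome_step[OF w d] syndrome_step[OF w e] cong_def .
  then have "[d = e] (mod 6)"
    by (simp only: cong_add_lcancel_nat)
  then have "d = e"
    using d e by (auto simp: cong_def)
  then show ?thesis
    by (simp add: u v)
qed

lemma ex_neighbour_syndrome_0:
  assumes "v \<in> pverts C\<^sub>6\<^sub>6\<^sub>2"
  shows "\<exists>c\<in>pverts C\<^sub>6\<^sub>6\<^sub>2. syndrome c = 0 \<and> (v = c \<or> (v, c) \<in> parcs C\<^sub>6\<^sub>6\<^sub>2)"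
proof (cases "syndrome v = 0")
  case True
  with assms show ?thesis by blast
next
  case False
  \<comment> \<open>The label that cancels the syndrome of \<open>v\<close>; it lies between 1 and 5
    because that syndrome is nonzero.\<close>
  define d where "d = 6 - syndrome v"
  have d: "d \<in> {1, 2, 3, 4, 5}"
    using False syndrome_less_6[of v] unfolding d_def by auto
  have "syndrome (step d v) = 0"
    unfolding syndrome_step[OF assms d] using syndrome_less_6[of v] by (simp add: d_def)
  moreover have "step d v \<in> pverts C\<^sub>6\<^sub>6\<^sub>2"
    using assms by (auto simp: pverts_C662 step_def)
  ultimately show ?thesis
    using assms d C662_arc_iff by blast
qed

theorem theorem9:
  shows "\<exists>D. perfect_1_code (cycle_graph 6 \<box> cycle_graph 6 \<box> cycle_graph 2) D"
proof -
  interpret pair_graph C\<^sub>6\<^sub>6\<^sub>2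
    by (intro pair_graph_cartesian_product pair_graph_cycle_graph) simp_all
  have wf: "pair_wf_digraph C\<^sub>6\<^sub>6\<^sub>2"
    by unfold_locales
  have sym: "(v, u) \<in> parcs C\<^sub>6\<^sub>6\<^sub>2" if "(u, v) \<in> parcs C\<^sub>6\<^sub>6\<^sub>2" for u v
    using that arcs_symmetric by simp
  have "perfect_1_code C\<^sub>6\<^sub>6\<^sub>2 {v \<in> pverts C\<^sub>6\<^sub>6\<^sub>2. syndrome v = 0}"
    unfolding perfect_1_code_def
  proof (intro conjI ballI impI)
    fix u v
    assume uv: "u \<in> {v \<in> pverts C\<^sub>6\<^sub>6\<^sub>2. syndrome v = 0}"
        "v \<in> {v \<in> pverts C\<^sub>6\<^sub>6\<^sub>2. syndrome v = 0}" "u \<noteq> v"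
    then have eq: "syndrome u = syndrome v"
      by simp
    show "3 \<le> graph_dist C\<^sub>6\<^sub>6\<^sub>2 u v"
    proof (rule graph_dist_ge_3[OF wf uv(3)])
      show "(u, v) \<notin> parcs C\<^sub>6\<^sub>6\<^sub>2"
        using syndrome_arc_neq eq by blast
    next
      fix w
      assume "(u, w) \<in> parcs C\<^sub>6\<^sub>6\<^sub>2" "(w, v) \<in> parcs C\<^sub>6\<^sub>6\<^sub>2"
      then show False
        \<comment> \<open>Reversing the first arc makes both codewords neighbours of the midpoint
          \<open>w\<close>.\<close>
        using syndrome_inj_on_neighbours[OF sym _ eq] uv(3) by blast
    qed
  next
    fix v
    assume "v \<in> pverts C\<^sub>6\<^sub>6\<^sub>2"
    then show "\<exists>x\<in>{v \<in> pverts C\<^sub>6\<^sub>6\<^sub>2. syndrome v = 0}. graph_dist C\<^sub>6\<^sub>6\<^sub>2 v x \<le> 1"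
      using ex_neighbour_syndrome_0[of v] graph_dist_le_1[OF wf, of v] by blast
  qed blast
  then show ?thesis ..
qed

end
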